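(* There are infinitely many primes $p$ such that for each integer $d \geq 4p^{3/4}+1$, there is a geometrically irreducible nontrivially blocking plane curve over $\mathbb{F}_p$ with degree $d$.
   Context: A plane curve $C=\{F=0\}\subset\mathbb{P}^2$ of degree $d$ over $\mathbb{F}_q$ is given by a nonzero homogeneous polynomial $F\in\mathbb{F}_q[x,y,z]$ of degree $d$; it is geometrically irreducible if $F$ is irreducible in $\overline{\mathbb{F}_q}[x,y,z]$. $C(\mathbb{F}_q)$ is the set of points $[x:y:z]\in\mathbb{P}^2(\mathbb{F}_q)$ with $F(x,y,z)=0$. A set $B\subseteq\mathbb{P}^2(\mathbb{F}_q)$ is a blocking set if every line of $\mathbb{P}^2$ defined over $\mathbb{F}_q$ (an $\mathbb{F}_q$-line) contains a point of $B$; it is a nontrivial blocking set if moreover it does not contain all the $\mathbb{F}_q$-points of any $\mathbb{F}_q$-line. The curve $C$ is nontrivially blocking over $\mathbb{F}_q$ if $C(\mathbb{F}_q)$ is a nontrivial blocking set. *)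

theory Defs
  imports Complex_Main "HOL-Algebra.Algebra" "HOL-Number_Theory.Residues"
begin

text \<open>
  \<open>K[x,y,z]\<close> is the univariate construction iterated three times. Elements of \<open>UP R\<close> are
  literally the finitely supported functions from exponents to coefficients in \<open>R\<close>, so for
  \<open>F\<close> in the carrier, \<open>F i j k\<close> is the coefficient of \<open>x^i y^j z^k\<close>.
\<close>

type_synonym 'a poly3 = "nat \<Rightarrow> nat \<Rightarrow> nat \<Rightarrow> 'a"

definition poly3_ring ::
    "('a, 'm) ring_scheme \<Rightarrow> (nat \<Rightarrow> nat \<Rightarrow> 'a, 'a poly3) up_ring" where
  "poly3_ring K = UP (UP (UP K))"

definition poly3_eval ::
    "('a, 'm) ring_scheme \<Rightarrow> 'a poly3 \<Rightarrow> 'a \<times> 'a \<times> 'a \<Rightarrow> 'a" where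
  "poly3_eval K F = (\<lambda>(x, y, z).
     finsum K
       (\<lambda>(i, j, k). F i j k \<otimes>\<^bsub>K\<^esub> x [^]\<^bsub>K\<^esub> i \<otimes>\<^bsub>K\<^esub> y [^]\<^bsub>K\<^esub> j \<otimes>\<^bsub>K\<^esub> z [^]\<^bsub>K\<^esub> k)
       {(i, j, k). F i j k \<noteq> \<zero>\<^bsub>K\<^esub>})"

definition homogeneous3 :: "('a, 'm) ring_scheme \<Rightarrow> nat \<Rightarrow> 'a poly3 \<Rightarrow> bool" where
  "homogeneous3 K d F \<longleftrightarrow> (\<forall>i j k. F i j k \<noteq> \<zero>\<^bsub>K\<^esub> \<longrightarrow> i + j + k = d)"

definition plane_curve :: "('a, 'm) ring_scheme \<Rightarrow> nat \<Rightarrow> 'a poly3 \<Rightarrow> bool" where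
  "plane_curve K d F \<longleftrightarrow>
     F \<in> carrier (poly3_ring K) \<and> F \<noteq> \<zero>\<^bsub>poly3_ring K\<^esub> \<and> homogeneous3 K d F"

text \<open>
  \<open>field.alg_closure K\<close> is the library's algebraic closure of \<open>K\<close>; \<open>K\<close> sits inside it through
  the ring homomorphism \<open>ring.indexed_const K\<close> (see \<open>field.alg_closureE\<close>), which is applied
  here to each coefficient.
\<close>

definition geometrically_irreducible :: "('a, 'm) ring_scheme \<Rightarrow> 'a poly3 \<Rightarrow> bool" where
  "geometrically_irreducible K F \<longleftrightarrow>
     ring_irreducible\<^bsub>poly3_ring (field.alg_closure K)\<^esub>
       (\<lambda>i j k. ring.indexed_const K (F i j k))"

definition nonzero_triples :: "('a, 'm) ring_scheme \<Rightarrow> ('a \<times> 'a \<times> 'a) set" where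
  "nonzero_triples K =
     carrier K \<times> carrier K \<times> carrier K - {(\<zero>\<^bsub>K\<^esub>, \<zero>\<^bsub>K\<^esub>, \<zero>\<^bsub>K\<^esub>)}"

text \<open>The point \<open>[x:y:z]\<close> is the class of all nonzero scalar multiples of \<open>(x,y,z)\<close>.\<close>

definition proj_point ::
    "('a, 'm) ring_scheme \<Rightarrow> 'a \<times> 'a \<times> 'a \<Rightarrow> ('a \<times> 'a \<times> 'a) set" where
  "proj_point K = (\<lambda>(x, y, z).
     {(c \<otimes>\<^bsub>K\<^esub> x, c \<otimes>\<^bsub>K\<^esub> y, c \<otimes>\<^bsub>K\<^esub> z) | c. c \<in> carrier K - {\<zero>\<^bsub>K\<^esub>}})"

definition proj_plane :: "('a, 'm) ring_scheme \<Rightarrow> ('a \<times> 'a \<times> 'a) set set" where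
  "proj_plane K = proj_point K ` nonzero_triples K"

definition proj_line ::
    "('a, 'm) ring_scheme \<Rightarrow> 'a \<times> 'a \<times> 'a \<Rightarrow> ('a \<times> 'a \<times> 'a) set set" where
  "proj_line K = (\<lambda>(a, b, c).
     {proj_point K (x, y, z) | x y z. (x, y, z) \<in> nonzero_triples K \<and>
        a \<otimes>\<^bsub>K\<^esub> x \<oplus>\<^bsub>K\<^esub> b \<otimes>\<^bsub>K\<^esub> y \<oplus>\<^bsub>K\<^esub> c \<otimes>\<^bsub>K\<^esub> z = \<zero>\<^bsub>K\<^esub>})"

definition proj_lines :: "('a, 'm) ring_scheme \<Rightarrow> ('a \<times> 'a \<times> 'a) set set set" where
  "proj_lines K = proj_line K ` nonzero_triples K"

definition curve_points ::
    "('a, 'm) ring_scheme \<Rightarrow> 'a poly3 \<Rightarrow> ('a \<times> 'a \<times> 'a) set set" where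
  "curve_points K F =
     {proj_point K v | v. v \<in> nonzero_triples K \<and> poly3_eval K F v = \<zero>\<^bsub>K\<^esub>}"

definition blocking_set ::
    "('a, 'm) ring_scheme \<Rightarrow> ('a \<times> 'a \<times> 'a) set set \<Rightarrow> bool" where
  "blocking_set K B \<longleftrightarrow> B \<subseteq> proj_plane K \<and> (\<forall>L\<in>proj_lines K. L \<inter> B \<noteq> {})"

definition nontrivial_blocking_set ::
    "('a, 'm) ring_scheme \<Rightarrow> ('a \<times> 'a \<times> 'a) set set \<Rightarrow> bool" where
  "nontrivial_blocking_set K B \<longleftrightarrow>
     blocking_set K B \<and> (\<forall>L\<in>proj_lines K. \<not> L \<subseteq> B)"

definition nontrivially_blocking :: "('a, 'm) ring_scheme \<Rightarrow> 'a poly3 \<Rightarrow> bool" where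
  "nontrivially_blocking K F \<longleftrightarrow> nontrivial_blocking_set K (curve_points K F)"

end

theory Submission
  imports "HOL-Real_Asymp.Real_Asymp" Defs "HOL-Computational_Algebra.Polynomial"
begin

text \<open>
  The curve is the projective closure of \<open>x^d + y^(d-1) = g(x,y)\<close> with \<open>g\<close> of degree at
  most \<open>d - 2\<close>. It meets the line \<open>z = 0\<close> only in the smooth point \<open>[0:1:0]\<close>; two
  components would both pass through that point, so the curve is geometrically irreducible.
  The point \<open>[0:1:0]\<close> blocks \<open>z = 0\<close> and the vertical lines, and the point at infinity of
  any other line is not on the curve. It remains to block the lines \<open>y = ax + b\<close>. Take \<open>m\<close>
  of the columns \<open>x = c\<close>; choosing greedily the \<open>m\<close> best points in each column leaves at most
  \<open>p^2 (1 - m/p)^m\<close> lines unblocked, hence none when \<open>m\<close> is about \<open>p^(3/4)\<close>. Interpolation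
  by some \<open>g\<close> of degree at most \<open>2m - 2\<close> puts all chosen points on the curve.
\<close>

section \<open>Irreducibility of forms with a total flex\<close>

lemma UP_coeff_eq: "q \<in> carrier (UP R) \<Longrightarrow> up_ring.coeff (UP R) q = q"
  by (simp add: UP_def)

context UP_domain
begin

text \<open>The coefficient of a product is a convolution, and here all its terms but one are
  killed. With \<open>h = id\<close> this yields the leading coefficient; in Eisenstein's argument
  it yields the lowest coefficient that survives reduction.\<close>

lemma hom_coeff_mult_single:
  assumes D: "ring D" and h: "h \<in> ring_hom R D"
    and p: "p \<in> carrier P" and q: "q \<in> carrier P"
    and vanish: "\<And>i. i \<le> a + b \<Longrightarrow> i \<noteq> a \<Longrightarrow>
      h (up_ring.coeff P p i) \<otimes>\<^bsub>D\<^esub> h (up_ring.coeff P q (a + b - i)) = \<zero>\<^bsub>D\<^esub>"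
  shows "h (up_ring.coeff P (p \<otimes>\<^bsub>P\<^esub> q) (a + b)) = h (up_ring.coeff P p a) \<otimes>\<^bsub>D\<^esub> h (up_ring.coeff P q b)"
proof -
  interpret D: ring D by (rule D)
  interpret H: ring_hom_ring R D h
    by (rule ring_hom_ringI2[OF R.ring_axioms D h])
  have "h (up_ring.coeff P (p \<otimes>\<^bsub>P\<^esub> q) (a + b)) =
      (\<Oplus>\<^bsub>D\<^esub>i\<in>{..a + b}. h (up_ring.coeff P p i) \<otimes>\<^bsub>D\<^esub> h (up_ring.coeff P q (a + b - i)))"
    using p q by (simp add: Pi_def o_def)
  also have "\<dots> = (\<Oplus>\<^bsub>D\<^esub>i\<in>{..a + b}. if a = i then h (up_ring.coeff P p i) \<otimes>\<^bsub>D\<^esub> h (up_ring.coeff P q b) else \<zero>\<^bsub>D\<^esub>)"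
    using p q vanish by (intro D.finsum_cong') (auto simp: Pi_def)
  also have "\<dots> = h (up_ring.coeff P p a) \<otimes>\<^bsub>D\<^esub> h (up_ring.coeff P q b)"
    using p q by (subst D.finsum_singleton) (auto simp: Pi_def)
  finally show ?thesis .
qed

lemma lcoeff_mult:
  assumes p: "p \<in> carrier P" and q: "q \<in> carrier P"
  shows "up_ring.coeff P (p \<otimes>\<^bsub>P\<^esub> q) (deg R p + deg R q) = up_ring.coeff P p (deg R p) \<otimes> up_ring.coeff P q (deg R q)"
proof -
  have "id (up_ring.coeff P (p \<otimes>\<^bsub>P\<^esub> q) (deg R p + deg R q)) =
      id (up_ring.coeff P p (deg R p)) \<otimes> id (up_ring.coeff P q (deg R q))"
  proof (rule hom_coeff_mult_single[OF R.ring_axioms _ p q])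
    show "id \<in> ring_hom R R" by (rule ring_hom_memI) auto
    fix i assume "i \<le> deg R p + deg R q" "i \<noteq> deg R p"
    then have "deg R p < i \<or> deg R q < deg R p + deg R q - i" by linarith
    then show "id (up_ring.coeff P p i) \<otimes> id (up_ring.coeff P q (deg R p + deg R q - i)) = \<zero>"
      using p q by (auto simp: deg_aboveD)
  qed
  then show ?thesis by simp
qed

lemma deg_zero_Units:
  assumes p: "p \<in> carrier P" and d: "deg R p = 0" and u: "up_ring.coeff P p 0 \<in> Units R"
  shows "p \<in> Units P"
proof -
  let ?c = "up_ring.coeff P p 0"
  have eq: "p = up_ring.monom P ?c 0" using deg_zero_impl_monom[OF p d] .
  have "up_ring.monom P ?c 0 \<otimes>\<^bsub>P\<^esub> up_ring.monom P (inv ?c) 0 = \<one>\<^bsub>P\<^esub>"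
    using UP_ring.monom_mult[OF UP_ring_axioms, of ?c "inv ?c" 0 0] UP_ring.monom_one[OF UP_ring_axioms] u
    by (simp add: P_def R.Units_closed)
  then have "p \<otimes>\<^bsub>P\<^esub> up_ring.monom P (inv ?c) 0 = \<one>\<^bsub>P\<^esub>" by (simp flip: eq)
  moreover have cl: "up_ring.monom P (inv ?c) 0 \<in> carrier P" using u by simp
  moreover have "up_ring.monom P (inv ?c) 0 \<otimes>\<^bsub>P\<^esub> p = p \<otimes>\<^bsub>P\<^esub> up_ring.monom P (inv ?c) 0"
    using UP_cring.UP_m_comm[OF UP_cring_axioms, folded P_def, OF cl p] .
  ultimately show ?thesis using p unfolding Units_def by (intro CollectI conjI bexI) simp_all
qed

text \<open>Eisenstein's criterion with the prime ideal given as the kernel of a homomorphism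
  \<open>h\<close> into a domain; \<open>const\<close> replaces the condition that the constant term
  avoids the square of that ideal. The lowest coefficients of two factors that survive
  \<open>h\<close> multiply to a surviving coefficient of \<open>F\<close>, which can only be the
  leading one. So each factor keeps only its leading coefficient, and if both degrees are positive,
  both constant terms lie in the kernel.\<close>

lemma eisenstein_irreducible:
  assumes D: "domain D" and h: "h \<in> ring_hom R D"
    and F: "F \<in> carrier P" and pos: "0 < deg R F"
    and lead: "up_ring.coeff P F (deg R F) \<in> Units R"
    and low: "\<And>i. i < deg R F \<Longrightarrow> h (up_ring.coeff P F i) = \<zero>\<^bsub>D\<^esub>"
    and const: "\<And>a b. a \<in> carrier R \<Longrightarrow> b \<in> carrier R \<Longrightarrow> h a = \<zero>\<^bsub>D\<^esub> \<Longrightarrow> h b = \<zero>\<^bsub>D\<^esub> \<Longrightarrow>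
      a \<otimes> b \<noteq> up_ring.coeff P F 0"
  shows "ring_irreducible\<^bsub>P\<^esub> F"
proof (rule domain.ring_irreducibleI[OF UP_domain])
  interpret D: domain D by (rule D)
  interpret H: ring_hom_ring R D h
    by (rule ring_hom_ringI2[OF R.ring_axioms D.ring_axioms h])
  have nz: "F \<noteq> \<zero>\<^bsub>P\<^esub>" using pos by auto
  then show "F \<in> carrier P - {\<zero>\<^bsub>P\<^esub>}" using F by simp
  show "F \<notin> Units P"
  proof
    assume "F \<in> Units P"
    then obtain G where G: "G \<in> carrier P" "F \<otimes>\<^bsub>P\<^esub> G = \<one>\<^bsub>P\<^esub>" unfolding Units_def by auto
    then have "G \<noteq> \<zero>\<^bsub>P\<^esub>" using F by auto
    then have "deg R F + deg R G = 0" using deg_mult[OF nz _ F G(1)] G(2) deg_one by simp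
    then show False using pos by simp
  qed
  \<comment> \<open>A homomorphism into a domain cannot kill a unit, so a factor with unit leading
    coefficient has a lowest surviving coefficient.\<close>
  have least: "\<exists>i \<le> deg R A. h (up_ring.coeff P A i) \<noteq> \<zero>\<^bsub>D\<^esub> \<and> (\<forall>j<i. h (up_ring.coeff P A j) = \<zero>\<^bsub>D\<^esub>)"
    if "A \<in> carrier P" "up_ring.coeff P A (deg R A) \<in> Units R" for A
  proof -
    have "h (up_ring.coeff P A (deg R A)) \<noteq> \<zero>\<^bsub>D\<^esub>"
    proof
      assume "h (up_ring.coeff P A (deg R A)) = \<zero>\<^bsub>D\<^esub>"
      then have "h (up_ring.coeff P A (deg R A) \<otimes> inv (up_ring.coeff P A (deg R A))) = \<zero>\<^bsub>D\<^esub>"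
        using that by (subst H.hom_mult) auto
      then show False using that by simp
    qed
    then show ?thesis
      using LeastI[of "\<lambda>i. h (up_ring.coeff P A i) \<noteq> \<zero>\<^bsub>D\<^esub>"] Least_le[of "\<lambda>i. h (up_ring.coeff P A i) \<noteq> \<zero>\<^bsub>D\<^esub>"]
        not_less_Least[of _ "\<lambda>i. h (up_ring.coeff P A i) \<noteq> \<zero>\<^bsub>D\<^esub>"] by blast
  qed
  fix A B assume A: "A \<in> carrier P" and B: "B \<in> carrier P" and AB: "F = A \<otimes>\<^bsub>P\<^esub> B"
  have ABnz: "A \<noteq> \<zero>\<^bsub>P\<^esub>" "B \<noteq> \<zero>\<^bsub>P\<^esub>" using nz A B AB by auto
  have deg: "deg R F = deg R A + deg R B" using deg_mult[OF ABnz A B] AB by simp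
  have "up_ring.coeff P A (deg R A) \<otimes> up_ring.coeff P B (deg R B) \<in> Units R"
    using lead lcoeff_mult[OF A B] deg AB by simp
  then have uA: "up_ring.coeff P A (deg R A) \<in> Units R" and uB: "up_ring.coeff P B (deg R B) \<in> Units R"
    using A B R.unit_factor R.m_comm by (metis coeff_closed)+
  show "A \<in> Units P \<or> B \<in> Units P"
  \<comment> \<open>A factor of degree 0 consists of its leading coefficient alone, which is a unit
    because it divides the unit leading coefficient of \<open>F\<close>.\<close>
  proof (cases "deg R A = 0 \<or> deg R B = 0")
    case True
    then show ?thesis using uA uB A B deg_zero_Units by metis
  next
    case False
    obtain a where a: "a \<le> deg R A" "h (up_ring.coeff P A a) \<noteq> \<zero>\<^bsub>D\<^esub>" "\<And>j. j < a \<Longrightarrow> h (up_ring.coeff P A j) = \<zero>\<^bsub>D\<^esub>"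
      using least[OF A uA] by blast
    obtain b where b: "b \<le> deg R B" "h (up_ring.coeff P B b) \<noteq> \<zero>\<^bsub>D\<^esub>" "\<And>j. j < b \<Longrightarrow> h (up_ring.coeff P B j) = \<zero>\<^bsub>D\<^esub>"
      using least[OF B uB] by blast
    have "h (up_ring.coeff P (A \<otimes>\<^bsub>P\<^esub> B) (a + b)) = h (up_ring.coeff P A a) \<otimes>\<^bsub>D\<^esub> h (up_ring.coeff P B b)"
    proof (rule hom_coeff_mult_single[OF D.ring_axioms h A B])
      fix i assume "i \<le> a + b" "i \<noteq> a"
      then have "i < a \<or> a + b - i < b" by linarith
      then show "h (up_ring.coeff P A i) \<otimes>\<^bsub>D\<^esub> h (up_ring.coeff P B (a + b - i)) = \<zero>\<^bsub>D\<^esub>"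
        using a(3) b(3) A B by auto
    qed
    also have "\<dots> \<noteq> \<zero>\<^bsub>D\<^esub>"
      using a(2) b(2) A B D.integral by (meson H.hom_closed coeff_closed)
    finally have "\<not> a + b < deg R F" using low AB by auto
    then have "a = deg R A" "b = deg R B" using a(1) b(1) deg by auto
    then have "h (up_ring.coeff P A 0) = \<zero>\<^bsub>D\<^esub>" "h (up_ring.coeff P B 0) = \<zero>\<^bsub>D\<^esub>" using False a(3) b(3) by auto
    moreover have "up_ring.coeff P F 0 = up_ring.coeff P A 0 \<otimes> up_ring.coeff P B 0" using AB A B by simp
    ultimately show ?thesis using const[of "up_ring.coeff P A 0" "up_ring.coeff P B 0"] A B by simp
  qed
qed

end

section \<open>Coefficientwise description of iterated polynomial rings\<close>

lemma UP_domain_imp: "domain R \<Longrightarrow> domain (UP R)"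
  using UP_domain.UP_domain[OF UP_domain.intro] by auto

lemma UP_mult_apply:
  assumes "ring R" "p \<in> carrier (UP R)" "q \<in> carrier (UP R)"
  shows "(p \<otimes>\<^bsub>UP R\<^esub> q) n = (\<Oplus>\<^bsub>R\<^esub>i\<in>{..n}. p i \<otimes>\<^bsub>R\<^esub> q (n - i))"
  using assms by (simp add: UP_def)

lemma UP_carrier_iff: "p \<in> carrier (UP R) \<longleftrightarrow> (\<forall>i. p i \<in> carrier R) \<and> (\<exists>n. \<forall>i>n. p i = \<zero>\<^bsub>R\<^esub>)"
  by (auto simp: UP_def up_def bound_def)

lemma UP_zero_eq: "\<zero>\<^bsub>UP R\<^esub> = (\<lambda>i. \<zero>\<^bsub>R\<^esub>)"
  by (simp add: UP_def)

lemma UP_one_eq: "\<one>\<^bsub>UP R\<^esub> = (\<lambda>i. if i = 0 then \<one>\<^bsub>R\<^esub> else \<zero>\<^bsub>R\<^esub>)"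
  by (simp add: UP_def)

lemma coeff_zero_hom:
  assumes "ring R"
  shows "(\<lambda>p. p 0) \<in> ring_hom (UP R) R"
proof -
  interpret R: ring R by fact
  show ?thesis
    by (rule ring_hom_memI) (auto simp: UP_def Pi_def mem_upD R.finsum_insert[of "{}", simplified])
qed

lemma UP_map_hom:
  assumes R: "ring R" and S: "ring S" and h: "h \<in> ring_hom R S"
  shows "(\<lambda>p i. h (p i)) \<in> ring_hom (UP R) (UP S)"
proof -
  interpret R: ring R by fact
  interpret S: ring S by fact
  interpret H: ring_hom_ring R S h by (rule ring_hom_ringI2[OF R S h])
  have cl: "(\<lambda>i. h (p i)) \<in> up S" if "p \<in> up R" for p
    using that by (auto simp: up_def bound_def Pi_def) (metis H.hom_zero)
  show ?thesis
  proof (rule ring_hom_memI)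
    show "(\<lambda>i. h (p i)) \<in> carrier (UP S)" if "p \<in> carrier (UP R)" for p
      using that cl by (simp add: UP_def)
    show "(\<lambda>i. h ((p \<otimes>\<^bsub>UP R\<^esub> q) i)) = (\<lambda>i. h (p i)) \<otimes>\<^bsub>UP S\<^esub> (\<lambda>i. h (q i))"
      if "p \<in> carrier (UP R)" "q \<in> carrier (UP R)" for p q
      using that cl mem_upD[of p R] mem_upD[of q R] by (auto simp: UP_def Pi_def o_def)
    show "(\<lambda>i. h ((p \<oplus>\<^bsub>UP R\<^esub> q) i)) = (\<lambda>i. h (p i)) \<oplus>\<^bsub>UP S\<^esub> (\<lambda>i. h (q i))"
      if "p \<in> carrier (UP R)" "q \<in> carrier (UP R)" for p q
      using that cl mem_upD[of p R] mem_upD[of q R] by (auto simp: UP_def)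
    show "(\<lambda>i. h (\<one>\<^bsub>UP R\<^esub> i)) = \<one>\<^bsub>UP S\<^esub>"
      by (auto simp: UP_def)
  qed
qed

lemma poly3_carrierI:
  assumes "\<And>i j k. F i j k \<in> carrier K"
    and "\<And>i j k. F i j k \<noteq> \<zero>\<^bsub>K\<^esub> \<Longrightarrow> i + j + k \<le> d"
  shows "F \<in> carrier (poly3_ring K)"
proof -
  have z: "F i j k = \<zero>\<^bsub>K\<^esub>" if "d < i + j + k" for i j k
    using assms(2)[of i j k] that by (meson not_le)
  show ?thesis unfolding poly3_ring_def
    by (auto simp: UP_carrier_iff UP_zero_eq assms(1) fun_eq_iff intro!: exI[of _ d] z)
qed

text \<open>Eisenstein at the prime \<open>z\<close> of \<open>L[y,z]\<close>: modulo \<open>z\<close> the form is \<open>x^d\<close>, and its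
  constant term in \<open>x\<close> is not divisible by \<open>z^2\<close>.\<close>

lemma total_flex_irreducible:
  assumes L: "domain L" and d: "2 \<le> d"
    and cl: "\<And>i j k. F i j k \<in> carrier L"
    and deg: "\<And>i j k. F i j k \<noteq> \<zero>\<^bsub>L\<^esub> \<Longrightarrow> i + j + k = d"
    and lead: "F d 0 0 = \<one>\<^bsub>L\<^esub>"
    and modz: "\<And>i j. i < d \<Longrightarrow> F i j 0 = \<zero>\<^bsub>L\<^esub>"
    and simple: "F 0 (d - 1) 1 \<noteq> \<zero>\<^bsub>L\<^esub>"
  shows "ring_irreducible\<^bsub>poly3_ring L\<^esub> F"
proof -
  let ?R = "UP (UP L)"
  interpret L: domain L by fact
  have D: "domain (UP L)" by (rule UP_domain_imp[OF L])
  interpret D: domain "UP L" by (rule D)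
  have R: "domain ?R" by (rule UP_domain_imp[OF D])
  interpret P: UP_domain ?R "UP ?R" using R by (auto intro: UP_domain.intro)
  \<comment> \<open>The innermost index is the exponent of z, so \<open>?h\<close> is the
    substitution z = 0 from L[y,z] to L[y], with kernel (z).\<close>
  let ?h = "\<lambda>r j. r j (0::nat)"
  have h: "?h \<in> ring_hom ?R (UP L)"
    using UP_map_hom[OF D.ring_axioms L.ring_axioms coeff_zero_hom[OF L.ring_axioms]] .
  have F: "F \<in> carrier (UP ?R)"
    using poly3_carrierI[of F L d] cl deg unfolding poly3_ring_def by fastforce
  note co = UP_coeff_eq[OF F]
  have one: "F d = \<one>\<^bsub>?R\<^esub>"
  proof (intro ext)
    fix j k
    have "F d j k = \<zero>\<^bsub>L\<^esub>" if "j \<noteq> 0 \<or> k \<noteq> 0" using deg[of d j k] that by auto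
    then show "F d j k = \<one>\<^bsub>?R\<^esub> j k"
      using lead by (cases "j = 0"; cases "k = 0") (simp_all only: UP_one_eq UP_zero_eq if_True if_False simp_thms)
  qed
  have degF: "deg ?R F = d"
  proof (rule le_antisym[OF P.deg_aboveI[OF _ F] P.deg_belowI[OF _ F]])
    show "up_ring.coeff (UP ?R) F m = \<zero>\<^bsub>?R\<^esub>" if "d < m" for m
    proof -
      have "F m j k = \<zero>\<^bsub>L\<^esub>" for j k
      proof (rule ccontr)
        assume "F m j k \<noteq> \<zero>\<^bsub>L\<^esub>"
        then show False using deg[of m j k] that by linarith
      qed
      then show ?thesis by (simp add: co UP_zero_eq fun_eq_iff)
    qed
    show "up_ring.coeff (UP ?R) F d \<noteq> \<zero>\<^bsub>?R\<^esub>"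
      unfolding co one using P.R.one_not_zero .
  qed
  have "ring_irreducible\<^bsub>UP ?R\<^esub> F"
  proof (rule P.eisenstein_irreducible[OF D h F])
    show "0 < deg ?R F" "up_ring.coeff (UP ?R) F (deg ?R F) \<in> Units ?R"
      using d by (simp_all add: degF co one)
    show "?h (up_ring.coeff (UP ?R) F i) = \<zero>\<^bsub>UP L\<^esub>" if "i < deg ?R F" for i
      using that modz by (simp add: degF co UP_zero_eq)
    \<comment> \<open>A product of two multiples of z is divisible by z^2, hence has no monomial
      y^(d-1) z; but \<open>F 0 (d - 1) 1\<close> is nonzero. The computation below extracts this
      one coefficient from the product.\<close>
    fix a b assume a: "a \<in> carrier ?R" and b: "b \<in> carrier ?R"
      and h0: "?h a = \<zero>\<^bsub>UP L\<^esub>" "?h b = \<zero>\<^bsub>UP L\<^esub>"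
    have a0: "a j 0 = \<zero>\<^bsub>L\<^esub>" and b0: "b j 0 = \<zero>\<^bsub>L\<^esub>" for j
      using fun_cong[OF h0(1), of j] fun_cong[OF h0(2), of j] by (simp_all add: UP_zero_eq)
    have aj: "a j \<in> carrier (UP L)" "b j \<in> carrier (UP L)" for j
      using a b UP_carrier_iff by metis+
    have ajk: "a j k \<in> carrier L" "b j k \<in> carrier L" for j k
      using aj UP_carrier_iff by metis+
    have fin: "(\<Oplus>\<^bsub>UP L\<^esub>i\<in>{..n}. f i) 1 = (\<Oplus>\<^bsub>L\<^esub>i\<in>{..n}. f i 1)"
      if "\<And>i. f i \<in> carrier (UP L)" for f :: "nat \<Rightarrow> nat \<Rightarrow> _" and n :: nat
    proof -
      interpret U: UP_domain L "UP L" using L by (auto intro: UP_domain.intro)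
      have "up_ring.coeff (UP L) (finsum (UP L) f {..n}) 1 = (\<Oplus>\<^bsub>L\<^esub>i\<in>{..n}. up_ring.coeff (UP L) (f i) 1)"
        using that by (intro U.coeff_finsum) (auto simp: Pi_def)
      then show ?thesis using that by (simp add: UP_coeff_eq)
    qed
    have "(a \<otimes>\<^bsub>?R\<^esub> b) (d - 1) 1 = (\<Oplus>\<^bsub>L\<^esub>i\<in>{..d - 1}. (a i \<otimes>\<^bsub>UP L\<^esub> b (d - 1 - i)) 1)"
      by (subst UP_mult_apply[OF D.ring_axioms a b], subst fin) (auto simp: aj)
    also have "\<dots> = (\<Oplus>\<^bsub>L\<^esub>i\<in>{..d - 1}. \<zero>\<^bsub>L\<^esub>)"
    proof (rule L.finsum_cong')
      fix i
      have "(a i \<otimes>\<^bsub>UP L\<^esub> b (d - 1 - i)) 1 = (\<Oplus>\<^bsub>L\<^esub>k\<in>{..1}. a i k \<otimes>\<^bsub>L\<^esub> b (d - 1 - i) (1 - k))"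
        by (rule UP_mult_apply[OF L.ring_axioms aj])
      also have "\<dots> = \<zero>\<^bsub>L\<^esub>" using a0 b0 ajk by (simp add: Pi_def)
      finally show "(a i \<otimes>\<^bsub>UP L\<^esub> b (d - 1 - i)) 1 = \<zero>\<^bsub>L\<^esub>" .
    qed auto
    also have "\<dots> = \<zero>\<^bsub>L\<^esub>" by simp
    finally show "a \<otimes>\<^bsub>?R\<^esub> b \<noteq> up_ring.coeff (UP ?R) F 0"
      using simple unfolding co by auto
  qed
  then show ?thesis unfolding poly3_ring_def .
qed

text \<open>The hypotheses only say which coefficients are 0, nonzero or 1, and the injective
  embedding of K into its algebraic closure preserves all of this.\<close>

lemma total_flex_geometrically_irreducible:
  assumes K: "field K" and d: "2 \<le> d"
    and cl: "\<And>i j k. F i j k \<in> carrier K"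
    and deg: "\<And>i j k. F i j k \<noteq> \<zero>\<^bsub>K\<^esub> \<Longrightarrow> i + j + k = d"
    and lead: "F d 0 0 = \<one>\<^bsub>K\<^esub>"
    and modz: "\<And>i j. i < d \<Longrightarrow> F i j 0 = \<zero>\<^bsub>K\<^esub>"
    and simple: "F 0 (d - 1) 1 \<noteq> \<zero>\<^bsub>K\<^esub>"
  shows "geometrically_irreducible K F"
proof -
  interpret K: field K by fact
  let ?L = "K.alg_closure" and ?h = "K.indexed_const"
  have "algebraic_closure ?L (?h ` carrier K)" and h: "?h \<in> ring_hom K ?L"
    by (rule K.alg_closureE)+
  then interpret L: algebraic_closure ?L "?h ` carrier K" by simp
  interpret H: ring_hom_ring K ?L ?h
    by (rule ring_hom_ringI2[OF K.ring_axioms L.ring_axioms h])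
  have inj: "?h x = \<zero>\<^bsub>?L\<^esub> \<longleftrightarrow> x = \<zero>\<^bsub>K\<^esub>" for x
    using K.indexed_const_is_inj H.hom_zero by (metis injD)
  show ?thesis unfolding geometrically_irreducible_def
    by (rule total_flex_irreducible[OF L.domain_axioms d])
      (use cl deg lead modz simple in \<open>auto simp: inj\<close>)
qed

section \<open>Covering by large fibers\<close>

text \<open>Greedy choice: with s values left, the most frequent one accounts for at least a
  fraction 1/s of the surviving elements. The factors (s-1)/s telescope to
  \<open>(card A - m) / card A\<close>; the bound is cross-multiplied to stay in the natural
  numbers.\<close>

lemma largest_fibers:
  fixes f :: "'a \<Rightarrow> 'b"
  assumes U: "finite U" and A: "finite A" and f: "f ` U \<subseteq> A" and m: "m \<le> card A"
  shows "\<exists>T\<subseteq>A. card T = m \<and> card A * card {u\<in>U. f u \<notin> T} \<le> (card A - m) * card U"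
  using m
proof (induction m)
  case 0
  show ?case by (intro exI[of _ "{}"]) simp
next
  case (Suc m)
  then obtain T where T: "T \<subseteq> A" "card T = m"
    and le: "card A * card {u\<in>U. f u \<notin> T} \<le> (card A - m) * card U" by auto
  define V where "V = {u\<in>U. f u \<notin> T}"
  define r where "r = card A - Suc m"
  have V: "finite V" using U by (simp add: V_def)
  have cAT: "card (A - T) = Suc r"
    using T A Suc.prems by (simp add: card_Diff_subset finite_subset r_def)
  have "V = (\<Union>t\<in>A - T. {u\<in>V. f u = t})" using f by (auto simp: V_def)
  also have "card \<dots> = (\<Sum>t\<in>A - T. card {u\<in>V. f u = t})"
    by (rule card_UN_disjoint) (use A V in auto)
  finally have cV: "card V = (\<Sum>t\<in>A - T. card {u\<in>V. f u = t})" .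
  \<comment> \<open>Some fiber is at least as large as the average over the \<open>Suc r\<close>
    remaining values.\<close>
  have "\<exists>t\<in>A - T. card V \<le> Suc r * card {u\<in>V. f u = t}"
  proof (rule ccontr)
    assume "\<not> ?thesis"
    then have "(\<Sum>t\<in>A - T. Suc r * card {u\<in>V. f u = t}) < (\<Sum>t\<in>A - T. card V)"
      using cAT A by (intro sum_strict_mono) force+
    then show False
      using cAT cV by (simp only: sum_distrib_left[symmetric] sum_constant of_nat_id)
  qed
  then obtain t where t: "t \<in> A - T" and tb: "card V \<le> Suc r * card {u\<in>V. f u = t}"
    by auto
  let ?W = "{u\<in>U. f u \<notin> insert t T}"
  have "card V = card ?W + card {u\<in>V. f u = t}"
    using U by (subst card_Un_disjoint[symmetric]) (auto simp: V_def intro!: arg_cong[of _ _ card])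
  then have "Suc r * card ?W \<le> r * card V" using tb by (simp add: algebra_simps)
  then have "Suc r * (card A * card ?W) \<le> r * (card A * card V)"
    by (metis mult.left_commute mult_le_mono2)
  \<comment> \<open>Since \<open>Suc r\<close> equals \<open>card A - m\<close>, the induction
    hypothesis supplies exactly the factor that cancels afterwards.\<close>
  also have "\<dots> \<le> r * (Suc r * card U)"
    using le Suc.prems by (intro mult_le_mono2) (simp add: V_def r_def Suc_diff_Suc)
  finally have "Suc r * (card A * card ?W) \<le> Suc r * (r * card U)" by (simp only: ac_simps)
  then have "card A * card ?W \<le> r * card U" by (simp only: Suc_mult_le_cancel1)
  moreover have "card (insert t T) = Suc m" using t T A by (simp add: finite_subset)
  ultimately show ?case using t T by (intro exI[of _ "insert t T"]) (simp add: r_def)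
qed

text \<open>Each round applies \<open>largest_fibers\<close> to the elements that escaped all
  earlier rounds, so each of the k rounds leaves at most a fraction \<open>1 - m / card A\<close> of
  them.\<close>

lemma greedy_cover:
  fixes f :: "nat \<Rightarrow> 'a \<Rightarrow> 'b"
  assumes U: "finite U" and A: "finite A" and f: "\<And>c. f c ` U \<subseteq> A" and m: "m \<le> card A"
  shows "\<exists>T. (\<forall>c. T c \<subseteq> A \<and> card (T c) = m) \<and>
    card A ^ k * card {u\<in>U. \<forall>c<k. f c u \<notin> T c} \<le> (card A - m) ^ k * card U"
proof (induction k)
  case 0
  \<comment> \<open>\<open>T\<close> is a total function whose values must all be m-sets, even at
    indices not yet treated; any fixed m-set serves.\<close>
  obtain T where "T \<subseteq> A" "card T = m" using m by (meson obtain_subset_with_card_n)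
  then show ?case by (intro exI[of _ "\<lambda>_. T"]) simp
next
  case (Suc k)
  then obtain T where T: "\<And>c. T c \<subseteq> A \<and> card (T c) = m"
    and le: "card A ^ k * card {u\<in>U. \<forall>c<k. f c u \<notin> T c} \<le> (card A - m) ^ k * card U" by blast
  define V where "V = {u\<in>U. \<forall>c<k. f c u \<notin> T c}"
  have "f k ` V \<subseteq> A" "finite V" using f U by (auto simp: V_def)
  then obtain S where S: "S \<subseteq> A" "card S = m"
    and leS: "card A * card {u\<in>V. f k u \<notin> S} \<le> (card A - m) * card V"
    using largest_fibers[OF _ A _ m, of V "f k"] by blast
  have eq: "{u\<in>U. \<forall>c<Suc k. f c u \<notin> (T(k := S)) c} = {u\<in>V. f k u \<notin> S}"
    by (auto simp: V_def less_Suc_eq)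
  have "card A ^ Suc k * card {u\<in>V. f k u \<notin> S} \<le> card A ^ k * ((card A - m) * card V)"
    using leS by (simp add: ac_simps)
  also have "\<dots> \<le> (card A - m) ^ Suc k * card U"
    using mult_le_mono2[OF le, of "card A - m"] by (simp add: V_def ac_simps)
  finally show ?case using T S unfolding eq[symmetric]
    by (intro exI[of _ "T(k := S)"]) simp
qed

text \<open>The set to be covered consists of the p^2 parameter pairs (a,b) of lines y = ax + b, and
  a fiber in column c is the set of lines through one point of that column. By \<open>small\<close>
  the number of uncovered lines is less than 1, hence 0.\<close>

lemma few_columns_meet_lines:
  fixes p m :: nat
  assumes m: "m \<le> p" and p: "0 < p" and small: "(p - m) ^ m * p ^ 2 < p ^ m"
  shows "\<exists>T :: nat \<Rightarrow> int set. (\<forall>c. T c \<subseteq> {0..<int p} \<and> card (T c) = m) \<and>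
    (\<forall>a b. \<exists>c<m. (a * int c + b) mod int p \<in> T c)"
proof -
  let ?A = "{0..<int p}"
  have "(\<lambda>u. (fst u * int c + snd u) mod int p) ` (?A \<times> ?A) \<subseteq> ?A" for c
    using p by auto
  note cover = greedy_cover[of "?A \<times> ?A" ?A "\<lambda>c u. (fst u * int c + snd u) mod int p" m m, OF _ _ this]
  obtain T where T: "\<forall>c. T c \<subseteq> ?A \<and> card (T c) = m"
    and le: "p ^ m * card {u\<in>?A \<times> ?A. \<forall>c<m. (fst u * int c + snd u) mod int p \<notin> T c} \<le>
      (p - m) ^ m * card (?A \<times> ?A)"
    using cover m by auto
  have "p ^ m * card {u\<in>?A \<times> ?A. \<forall>c<m. (fst u * int c + snd u) mod int p \<notin> T c} < p ^ m * 1"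
  proof -
    have "(p - m) ^ m * card (?A \<times> ?A) < p ^ m"
      using small by (simp add: power2_eq_square)
    then show ?thesis using le by linarith
  qed
  then have "card {u\<in>?A \<times> ?A. \<forall>c<m. (fst u * int c + snd u) mod int p \<notin> T c} = 0"
    by (simp only: mult_less_cancel1) simp
  then have none: "{u\<in>?A \<times> ?A. \<forall>c<m. (fst u * int c + snd u) mod int p \<notin> T c} = {}"
    by (subst (asm) card_0_eq) (auto intro: finite_subset[of _ "?A \<times> ?A"])
  \<comment> \<open>The covering concerns reduced parameters; arbitrary integers a and b are handled
    by reducing them modulo p.\<close>
  have "\<exists>c<m. (a * int c + b) mod int p \<in> T c" for a b
  proof -
    have "(a mod int p, b mod int p) \<in> ?A \<times> ?A" using p by simp
    then obtain c where "c < m" "(a mod int p * int c + b mod int p) mod int p \<in> T c"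
      using none[THEN equalityD1, THEN subsetD, of "(a mod int p, b mod int p)"] by auto
    moreover have "(a mod int p * int c + b mod int p) mod int p = (a * int c + b) mod int p"
      using cong_add[OF cong_mult[OF _ cong_refl], of "a mod int p" a "int p" "b mod int p" b "int c"]
      by (simp add: cong_def)
    ultimately show ?thesis by auto
  qed
  then show ?thesis using T by blast
qed

section \<open>Polynomials modulo a prime\<close>

lemma not_dvd_diff_residues:
  fixes p :: nat
  assumes "x \<in> {0..<int p}" "y \<in> {0..<int p}" "x \<noteq> y"
  shows "\<not> int p dvd x - y"
  using assms by (metis atLeastLessThan_iff mod_eq_dvd_iff mod_pos_pos_trivial)

text \<open>Newton interpolation: \<open>v a + (t - a) * r\<close>, where \<open>r\<close>
  interpolates the divided differences on the remaining nodes, with inverses modulo p as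
  denominators. The alternative \<open>q = 0\<close> is what the empty set of nodes requires, as no
  degree is below 0.\<close>

lemma interpolation_mod_prime:
  fixes p :: nat and v :: "int \<Rightarrow> int"
  assumes p: "Factorial_Ring.prime p" and S: "S \<subseteq> {0..<int p}"
  shows "\<exists>q :: int poly. (q = 0 \<or> degree q < card S) \<and> (\<forall>t\<in>S. [poly q t = v t] (mod int p))"
proof -
  have "finite S" using S finite_subset by blast
  then show ?thesis using S
  proof (induction S arbitrary: v rule: finite_induct)
    case empty
    then show ?case by (intro exI[of _ 0]) simp
  next
    case (insert a S)
    have "\<exists>w. [(t - a) * w = 1] (mod int p)" if "t \<in> S" for t
    proof -
      have "\<not> int p dvd t - a" using insert.prems insert.hyps that by (intro not_dvd_diff_residues) auto
      then have "coprime (t - a) (int p)"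
        using p by (metis coprime_commute prime_imp_coprime prime_nat_int_transfer)
      then show ?thesis by (rule cong_solve_coprime_int)
    qed
    then obtain w where w: "\<And>t. t \<in> S \<Longrightarrow> [(t - a) * w t = 1] (mod int p)" by metis
    obtain r where r: "r = 0 \<or> degree r < card S"
      and rv: "\<And>t. t \<in> S \<Longrightarrow> [poly r t = w t * (v t - v a)] (mod int p)"
      using insert.IH[of "\<lambda>t. w t * (v t - v a)"] insert.prems by auto
    let ?q = "[:v a:] + [:-a, 1:] * r"
    have "degree ?q < card (insert a S)"
    proof (cases "r = 0")
      case False
      then have "degree ([:-a, 1:] * r) < Suc (card S)" using r by (subst degree_mult_eq) auto
      then have "degree ?q < Suc (card S)" by (intro degree_add_less) auto
      then show ?thesis using insert.hyps by simp
    qed (use insert.hyps in simp)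
    moreover have "[poly ?q t = v t] (mod int p)" if "t \<in> insert a S" for t
    proof (cases "t = a")
      case False
      then have t: "t \<in> S" using that by simp
      have "[v a + (t - a) * poly r t = v a + (t - a) * (w t * (v t - v a))] (mod int p)"
        using rv[OF t] by (intro cong_add cong_mult) auto
      also have "v a + (t - a) * (w t * (v t - v a)) = v a + ((t - a) * w t) * (v t - v a)"
        by simp
      also have "[\<dots> = v a + 1 * (v t - v a)] (mod int p)"
        using w[OF t] by (intro cong_add cong_mult) auto
      finally show ?thesis by (simp add: algebra_simps)
    qed simp
    ultimately show ?case by blast
  qed
qed

text \<open>Lagrange's bound on roots over F_p, carried out with integer polynomials. Splitting off
  X - a over the integers leaves a remainder divisible by p and a monic quotient, which vanishes
  modulo p at every other root because p does not divide x - a.\<close>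

lemma monic_roots_mod_prime:
  fixes p :: nat and q :: "int poly"
  assumes p: "Factorial_Ring.prime p" and S: "S \<subseteq> {0..<int p}" and q: "lead_coeff q = 1"
    and roots: "\<And>x. x \<in> S \<Longrightarrow> [poly q x = 0] (mod int p)"
  shows "card S \<le> degree q"
  using assms(2-)
proof (induction "degree q" arbitrary: q S)
  case 0
  then have "q = 1" by (metis degree_0_id of_int_1 one_pCons)
  have "x \<notin> S" for x
    using 0 \<open>q = 1\<close> p by (auto simp: cong_0_iff dest!: prime_gt_1_nat)
  then show ?case by (metis card.empty equals0I le0)
next
  case (Suc n)
  show ?case
  proof (cases "S = {}")
    case False
    then obtain a where a: "a \<in> S" by auto
    define r where "r = synthetic_div q a"
    have qr: "q = [:-a, 1:] * r + [:poly q a:]"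
      unfolding r_def by (rule synthetic_div_correct'[symmetric])
    have degr: "degree r = n" using Suc(2) by (simp add: r_def degree_synthetic_div)
    have r0: "r \<noteq> 0"
    proof
      assume "r = 0"
      then have "q = [:poly q a:]" using qr by simp
      then show False using Suc(2) by (metis degree_pCons_0 nat.distinct(1))
    qed
    \<comment> \<open>The remainder is constant while the product has positive degree, so the
      quotient inherits leading coefficient 1.\<close>
    have "degree [:poly q a:] < degree ([:-a, 1:] * r)"
      using r0 by (subst degree_mult_eq) auto
    note lead = lead_coeff_add_le[OF this]
    have "lead_coeff r = lead_coeff ([:-a, 1:] * r)" by (simp only: lead_coeff_mult) simp
    also have "\<dots> = lead_coeff ([:-a, 1:] * r + [:poly q a:])"
      by (simp only: lead add.commute)
    finally have lr: "lead_coeff r = 1" by (simp only: qr[symmetric] Suc.prems(2))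
    have "[poly r x = 0] (mod int p)" if "x \<in> S - {a}" for x
    proof -
      have "poly q x = (x - a) * poly r x + poly q a"
        by (subst qr) (simp add: algebra_simps)
      moreover have "int p dvd poly q x" "int p dvd poly q a"
        using Suc.prems that a by (auto simp: cong_0_iff)
      ultimately have "int p dvd (x - a) * poly r x" by (metis dvd_add_left_iff)
      moreover have "\<not> int p dvd x - a" using Suc.prems(1) that a by (intro not_dvd_diff_residues) auto
      ultimately show ?thesis
        using p by (metis cong_0_iff prime_dvd_mult_iff prime_nat_int_transfer)
    qed
    then have "card (S - {a}) \<le> n"
      using Suc.hyps(1)[of r "S - {a}"] degr lr Suc.prems(1) by auto
    then show ?thesis using Suc(2) a Suc.prems(1) by (simp add: card_Diff_singleton)
  qed simp
qed

section \<open>Bivariate interpolation with bounded total degree\<close>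

definition bipoly :: "nat \<Rightarrow> (int \<Rightarrow> int \<Rightarrow> int) \<Rightarrow> bool" where
  "bipoly n g \<longleftrightarrow> (\<exists>G :: nat \<Rightarrow> nat \<Rightarrow> int. \<forall>x y. g x y = (\<Sum>i\<le>n. \<Sum>j\<le>n - i. G i j * x ^ i * y ^ j))"

lemma bipoly_monom:
  assumes "a + b \<le> n"
  shows "bipoly n (\<lambda>x y. c * x ^ a * y ^ b)"
proof -
  have "(\<Sum>i\<le>n. \<Sum>j\<le>n - i. (if i = a \<and> j = b then c else 0) * x ^ i * y ^ j) = c * x ^ a * y ^ b"
    for x y :: int
  proof -
    have "(\<Sum>j\<le>n - i. (if i = a \<and> j = b then c else 0) * x ^ i * y ^ j) =
        (if i = a then c * x ^ a * y ^ b else 0)" if "i \<le> n" for i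
    proof (cases "i = a")
      case True
      have "(\<Sum>j\<le>n - i. (if i = a \<and> j = b then c else 0) * x ^ i * y ^ j) =
          (\<Sum>j\<le>n - i. if j = b then c * x ^ a * y ^ b else 0)"
        using True by (intro sum.cong) auto
      then show ?thesis using assms True by simp
    qed simp
    then have "(\<Sum>i\<le>n. \<Sum>j\<le>n - i. (if i = a \<and> j = b then c else 0) * x ^ i * y ^ j) =
        (\<Sum>i\<le>n. if i = a then c * x ^ a * y ^ b else 0)"
      by (intro sum.cong) auto
    then show ?thesis using assms by simp
  qed
  then show ?thesis unfolding bipoly_def
    by (intro exI[of _ "\<lambda>i j. if i = a \<and> j = b then c else 0"]) (simp only: simp_thms)
qed

lemma bipoly_add:
  assumes "bipoly n f" "bipoly n g"
  shows "bipoly n (\<lambda>x y. f x y + g x y)"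
proof -
  obtain F G where "\<And>x y. f x y = (\<Sum>i\<le>n. \<Sum>j\<le>n - i. F i j * x ^ i * y ^ j)"
      "\<And>x y. g x y = (\<Sum>i\<le>n. \<Sum>j\<le>n - i. G i j * x ^ i * y ^ j)"
    using assms unfolding bipoly_def by blast
  then show ?thesis unfolding bipoly_def
    by (intro exI[of _ "\<lambda>i j. F i j + G i j"]) (simp add: distrib_right sum.distrib)
qed

lemma bipoly_uminus:
  assumes "bipoly n f"
  shows "bipoly n (\<lambda>x y. - f x y)"
proof -
  obtain F where "\<And>x y. f x y = (\<Sum>i\<le>n. \<Sum>j\<le>n - i. F i j * x ^ i * y ^ j)"
    using assms unfolding bipoly_def by blast
  then show ?thesis unfolding bipoly_def
    by (intro exI[of _ "\<lambda>i j. - F i j"]) (simp add: sum_negf)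
qed

lemma bipoly_sum:
  assumes "\<And>i. i \<in> I \<Longrightarrow> bipoly n (f i)"
  shows "bipoly n (\<lambda>x y. \<Sum>i\<in>I. f i x y)"
  using assms
proof (induction I rule: infinite_finite_induct)
  case (insert i I)
  then show ?case by (simp add: bipoly_add)
qed (use bipoly_monom[of 0 0 n 0] in simp_all)

text \<open>Interpolation in two stages: first in y within each column, giving m coefficients per
  column, then in x across the columns for each of these coefficients. The condition
  \<open>m \<le> p\<close> keeps the m columns distinct modulo p.\<close>

lemma column_interpolation:
  fixes p m :: nat and v :: "int \<Rightarrow> int \<Rightarrow> int"
  assumes p: "Factorial_Ring.prime p" and m: "m \<le> p"
    and T: "\<And>c. T c \<subseteq> {0..<int p} \<and> card (T c) = m"
  shows "\<exists>A. \<forall>c<m. \<forall>t\<in>T c. [(\<Sum>i<m. \<Sum>j<m. A i j * int c ^ i * t ^ j) = v (int c) t] (mod int p)"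
proof -
  have ev: "poly q x = (\<Sum>j<n. coeff q j * x ^ j)" if "q = 0 \<or> degree q < n" for n and q :: "int poly" and x
  proof (cases "q = 0")
    case False
    then have "degree q < n" using that by simp
    then show ?thesis unfolding poly_altdef
      by (intro sum.mono_neutral_left) (auto simp: coeff_eq_0)
  qed simp
  have "\<exists>q :: int poly. (q = 0 \<or> degree q < m) \<and> (\<forall>t\<in>T c. [poly q t = v (int c) t] (mod int p))" for c
    using interpolation_mod_prime[OF p, of "T c" "v (int c)"] T[of c] by simp
  then obtain q :: "nat \<Rightarrow> int poly" where q: "\<And>c. q c = 0 \<or> degree (q c) < m"
    and qv: "\<And>c t. t \<in> T c \<Longrightarrow> [poly (q c) t = v (int c) t] (mod int p)" by metis
  \<comment> \<open>Second stage: the j-th coefficient of the column polynomials, as a function of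
    the column.\<close>
  have "\<exists>r :: int poly. (r = 0 \<or> degree r < m) \<and>
      (\<forall>c\<in>{0..<int m}. [poly r c = coeff (q (nat c)) j] (mod int p))" for j
    using interpolation_mod_prime[OF p, of "{0..<int m}" "\<lambda>c. coeff (q (nat c)) j"] m by simp
  then obtain r :: "nat \<Rightarrow> int poly" where r: "\<And>j. r j = 0 \<or> degree (r j) < m"
    and rv: "\<And>c j. c \<in> {0..<int m} \<Longrightarrow> [poly (r j) c = coeff (q (nat c)) j] (mod int p)" by metis
  have "[(\<Sum>i<m. \<Sum>j<m. coeff (r j) i * int c ^ i * t ^ j) = v (int c) t] (mod int p)"
    if "c < m" "t \<in> T c" for c t
  proof -
    have "(\<Sum>i<m. \<Sum>j<m. coeff (r j) i * int c ^ i * t ^ j) = (\<Sum>j<m. poly (r j) (int c) * t ^ j)"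
      by (subst sum.swap) (simp add: ev[OF r] sum_distrib_right)
    also have "[\<dots> = (\<Sum>j<m. coeff (q c) j * t ^ j)] (mod int p)"
      using rv[of "int c"] that by (intro cong_sum cong_mult) auto
    also have "(\<Sum>j<m. coeff (q c) j * t ^ j) = poly (q c) t" by (simp add: ev[OF q])
    also have "[\<dots> = v (int c) t] (mod int p)" using qv that by simp
    finally show ?thesis .
  qed
  then show ?thesis by (intro exI[of _ "\<lambda>i j. coeff (r j) i"]) blast
qed

text \<open>The expression is monic of degree e in y, because \<open>m \<le> e\<close> and
  \<open>0 < e\<close> keep all other terms below y^e; it has at most e < p roots among the p
  residues. This keeps vertical lines from lying in the curve.\<close>

lemma monic_not_zero_mod_prime:
  fixes p m e :: nat and h :: "nat \<Rightarrow> int"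
  assumes p: "Factorial_Ring.prime p" and m: "m \<le> e" and e0: "0 < e" and e: "e < p"
  shows "\<exists>y. \<not> [c + y ^ e - (\<Sum>j<m. h j * y ^ j) = 0] (mod int p)"
proof (rule ccontr)
  assume no: "\<not> ?thesis"
  define r where "r = [:c:] - (\<Sum>j<m. monom (h j) j)"
  have "degree r < e" unfolding r_def
    using m e0 by (intro degree_diff_less degree_sum_less) (auto intro: le_less_trans[OF degree_monom_le])
  then have "degree (monom 1 e + r) = e" "lead_coeff (monom 1 e + r) = 1"
    by (auto simp: degree_monom_eq degree_add_eq_left coeff_eq_0)
  moreover have "poly (monom 1 e + r) y = c + y ^ e - (\<Sum>j<m. h j * y ^ j)" for y
    by (simp add: r_def poly_monom poly_sum)
  ultimately show False
    using monic_roots_mod_prime[OF p order_refl, of "monom 1 e + r"] no e by simp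
qed

section \<open>Evaluating forms over residue rings by integer arithmetic\<close>

lemma (in residues) finsum_int_mod:
  assumes "finite I" "\<And>i. i \<in> I \<Longrightarrow> f i \<in> carrier R"
  shows "finsum R f I = (\<Sum>i\<in>I. f i) mod m"
proof -
  have "finsum R f I = (\<Oplus>i\<in>I. f i mod m)"
    using assms(2) by (intro finsum_cong') (auto simp: res_carrier_eq)
  then show ?thesis using assms(1) by (simp add: sum_cong)
qed

lemma (in residues) mod_carrier: "x mod m \<in> carrier R"
  using m_gt_one by (simp add: res_carrier_eq)

text \<open>The evaluation sums over the exact support of the reduced coefficients. Passing to a
  fixed box of exponents adds only terms divisible by the modulus and makes the sum
  manageable.\<close>

lemma (in residues) poly3_eval_mod:
  assumes N: "\<And>i j k. B i j k mod m \<noteq> 0 \<Longrightarrow> i \<le> N \<and> j \<le> N \<and> k \<le> N"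
  shows "poly3_eval R (\<lambda>i j k. B i j k mod m) (x mod m, y mod m, z mod m) =
    (\<Sum>(i, j, k)\<in>{..N} \<times> {..N} \<times> {..N}. B i j k * x ^ i * y ^ j * z ^ k) mod m"
proof -
  let ?S = "{(i, j, k). B i j k mod m \<noteq> 0}"
  let ?c = "\<lambda>(i, j, k). B i j k * x ^ i * y ^ j * z ^ k"
  let ?X = "{..N} \<times> {..N} \<times> {..N}"
  have sub: "?S \<subseteq> ?X" using N by auto
  then have fin: "finite ?S" by (rule finite_subset) simp
  have monomial: "(B i j k mod m) \<otimes> (x mod m) [^] i \<otimes> (y mod m) [^] j \<otimes> (z mod m) [^] k =
      (B i j k * x ^ i * y ^ j * z ^ k) mod m" for i j k
    by (simp add: pow_cong mult_cong)
  have "poly3_eval R (\<lambda>i j k. B i j k mod m) (x mod m, y mod m, z mod m) =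
      (\<Oplus>t\<in>?S. ?c t mod m)"
    unfolding poly3_eval_def by (simp add: monomial res_zero_eq split_def)
  also have "\<dots> = (\<Sum>t\<in>?S. ?c t) mod m" using fin by (simp add: sum_cong)
  also have "\<dots> = (\<Sum>t\<in>?X. ?c t) mod m"
  proof -
    have "m dvd ?c t" if "t \<in> ?X - ?S" for t
      using that by (auto simp: dvd_eq_mod_eq_0[symmetric])
    then have "m dvd (\<Sum>t\<in>?X - ?S. ?c t)" by (intro dvd_sum)
    moreover have "(\<Sum>t\<in>?X. ?c t) = (\<Sum>t\<in>?X - ?S. ?c t) + (\<Sum>t\<in>?S. ?c t)"
      using sub by (intro sum.subset_diff) auto
    ultimately show ?thesis by (simp add: mod_eq_dvd_iff)
  qed
  finally show ?thesis .
qed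

section \<open>Blocking curves\<close>

text \<open>\<open>F\<close> is the reduction of the homogenization of x^d + y^(d-1) - g, and
  \<open>H\<close> is the corresponding integer polynomial function. Exporting \<open>H\<close>
  turns later questions about points of the curve into congruences of integers.\<close>

lemma total_flex_form:
  fixes p d :: nat and g :: "int \<Rightarrow> int \<Rightarrow> int"
  assumes p: "Factorial_Ring.prime p" and d: "2 \<le> d" and g: "bipoly (d - 2) g"
  defines "K \<equiv> residue_ring (int p)"
  shows "\<exists>F H. plane_curve K d F \<and> geometrically_irreducible K F \<and>
    (\<forall>x y z. poly3_eval K F (x mod int p, y mod int p, z mod int p) = H x y z mod int p) \<and>
    (\<forall>c x y z. H (c * x) (c * y) (c * z) = c ^ d * H x y z) \<and>
    (\<forall>x y. H x y 0 = x ^ d) \<and>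
    (\<forall>x y. H x y 1 = x ^ d + y ^ (d - 1) - g x y)"
proof -
  interpret residues_prime p K
    using p by unfold_locales (simp_all add: K_def)
  let ?P = "Sigma {..d - 2} (\<lambda>i. {..d - 2 - i})"
  let ?X = "{..d} \<times> {..d} \<times> {..d}"
  let ?f = "\<lambda>(i, j). (i, j, d - i - j)"
  obtain G where G: "\<And>x y. g x y = (\<Sum>i\<le>d - 2. \<Sum>j\<le>d - 2 - i. G i j * x ^ i * y ^ j)"
    using g unfolding bipoly_def by blast
  define I where "I = ?f ` ?P"
  \<comment> \<open>As g has degree at most d - 2, its homogenized monomials all contain z^2. They
    therefore affect neither the restriction to z = 0 nor the coefficient of y^(d-1) z.\<close>
  have I: "i + j + k = d \<and> 2 \<le> k" if "(i, j, k) \<in> I" for i j k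
    using that d by (auto simp: I_def)
  define B where "B i j k = (if (i, j, k) = (d, 0, 0) then 1 else 0) +
    (if (i, j, k) = (0, d - 1, 1) then 1 else 0) -
    (if (i, j, k) \<in> I then G i j else 0)" for i j k :: nat
  define F where "F = (\<lambda>i j k. B i j k mod int p)"
  define H where "H x y z = x ^ d + y ^ (d - 1) * z -
    (\<Sum>(i, j)\<in>?P. G i j * x ^ i * y ^ j * z ^ (d - i - j))" for x y z :: int
  have p1: "1 < int p" using p prime_gt_1_nat by simp
  have Bdeg: "i + j + k = d" if "B i j k \<noteq> 0" for i j k
  proof (rule ccontr)
    assume "i + j + k \<noteq> d"
    then have "(i, j, k) \<noteq> (d, 0, 0)" "(i, j, k) \<noteq> (0, d - 1, 1)" "(i, j, k) \<notin> I"
      using d I by auto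
    then show False using that unfolding B_def by (simp only: if_False)
  qed
  have Fdeg: "i + j + k = d" if "F i j k \<noteq> 0" for i j k
    using that Bdeg unfolding F_def by (metis mod_0)
  have Fcl: "F i j k \<in> carrier K" for i j k unfolding F_def by (rule mod_carrier)
  have notI: "(i, j, 0) \<notin> I" "(i, j, Suc 0) \<notin> I" for i j
    using I by fastforce+
  have lead: "F d 0 0 = 1" using notI d p1 by (simp add: F_def B_def)
  have simple: "F 0 (d - 1) 1 = 1" using notI d p1 by (simp add: F_def B_def)
  have modz: "F i j 0 = 0" if "i < d" for i j using notI that by (simp add: F_def B_def)
  have Fcar: "F \<in> carrier (poly3_ring K)"
    by (rule poly3_carrierI[of F K d]) (use Fcl Fdeg in \<open>auto simp: res_zero_eq\<close>)
  have "F \<noteq> \<zero>\<^bsub>poly3_ring K\<^esub>"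
  proof
    assume "F = \<zero>\<^bsub>poly3_ring K\<^esub>"
    then have "F d 0 0 = 0" by (simp add: poly3_ring_def UP_zero_eq res_zero_eq)
    then show False using lead by simp
  qed
  then have plane: "plane_curve K d F"
    using Fcar Fdeg unfolding plane_curve_def homogeneous3_def by (simp add: res_zero_eq)
  have irr: "geometrically_irreducible K F"
    by (rule total_flex_geometrically_irreducible[OF is_field d])
      (use Fcl Fdeg lead simple modz in \<open>simp_all add: res_zero_eq res_one_eq\<close>)
  have delta: "(\<Sum>(i, j, k)\<in>?X. (if (i, j, k) = (a, b, c) then 1 else 0) * x ^ i * y ^ j * z ^ k) =
      x ^ a * y ^ b * z ^ c" if "a \<le> d" "b \<le> d" "c \<le> d" for a b c :: nat and x y z :: int
  proof -
    have "(\<Sum>(i, j, k)\<in>?X. (if (i, j, k) = (a, b, c) then 1 else 0) * x ^ i * y ^ j * z ^ k) =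
        (\<Sum>t\<in>?X. if t = (a, b, c) then x ^ a * y ^ b * z ^ c else 0)"
      by (intro sum.cong) auto
    then show ?thesis using that by simp
  qed
  have sumP: "(\<Sum>(i, j, k)\<in>?X. (if (i, j, k) \<in> I then G i j else 0) * x ^ i * y ^ j * z ^ k) =
      (\<Sum>(i, j)\<in>?P. G i j * x ^ i * y ^ j * z ^ (d - i - j))" (is "sum ?h ?X = _") for x y z :: int
  proof -
    have "sum ?h ?X = sum ?h I"
    proof (rule sum.mono_neutral_right)
      show "I \<subseteq> ?X" using I by fastforce
    qed auto
    also have "\<dots> = sum (?h \<circ> ?f) ?P" unfolding I_def by (rule sum.reindex) (auto simp: inj_on_def)
    also have "\<dots> = (\<Sum>(i, j)\<in>?P. G i j * x ^ i * y ^ j * z ^ (d - i - j))"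
      by (rule sum.cong) (auto simp: I_def)
    finally show ?thesis .
  qed
  have BH: "(\<Sum>(i, j, k)\<in>?X. B i j k * x ^ i * y ^ j * z ^ k) = H x y z" for x y z
  proof -
    have "(\<Sum>(i, j, k)\<in>?X. B i j k * x ^ i * y ^ j * z ^ k) =
        (\<Sum>(i, j, k)\<in>?X. (if (i, j, k) = (d, 0, 0) then 1 else 0) * x ^ i * y ^ j * z ^ k) +
        (\<Sum>(i, j, k)\<in>?X. (if (i, j, k) = (0, d - 1, 1) then 1 else 0) * x ^ i * y ^ j * z ^ k) -
        (\<Sum>(i, j, k)\<in>?X. (if (i, j, k) \<in> I then G i j else 0) * x ^ i * y ^ j * z ^ k)"
      unfolding sum.distrib[symmetric] sum_subtractf[symmetric]
      by (rule sum.cong) (simp_all only: B_def split_def distrib_right left_diff_distrib)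
    then show ?thesis using d by (simp only: delta sumP H_def) (simp add: delta)
  qed
  have "poly3_eval K F (x mod int p, y mod int p, z mod int p) = H x y z mod int p" for x y z
    unfolding F_def BH[symmetric]
  proof (rule poly3_eval_mod)
    fix i j k assume "B i j k mod int p \<noteq> 0"
    then have "i + j + k = d" using Bdeg by (metis mod_0)
    then show "i \<le> d \<and> j \<le> d \<and> k \<le> d" by simp
  qed
  moreover have "H (c * x) (c * y) (c * z) = c ^ d * H x y z" for c x y z
  proof -
    have "(\<Sum>(i, j)\<in>?P. G i j * (c * x) ^ i * (c * y) ^ j * (c * z) ^ (d - i - j)) =
        c ^ d * (\<Sum>(i, j)\<in>?P. G i j * x ^ i * y ^ j * z ^ (d - i - j))"
      unfolding sum_distrib_left
    proof (rule sum.cong[OF refl], clarify)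
      fix i j assume "i \<le> d - 2" "j \<le> d - 2 - i"
      then have "c ^ d = c ^ i * c ^ j * c ^ (d - i - j)" by (simp flip: power_add)
      then show "G i j * (c * x) ^ i * (c * y) ^ j * (c * z) ^ (d - i - j) =
          c ^ d * (G i j * x ^ i * y ^ j * z ^ (d - i - j))"
        by (simp add: power_mult_distrib)
    qed
    moreover have "c ^ d = c ^ (d - 1) * c" using d by (metis power_minus_mult zero_less_numeral less_le_trans)
    ultimately show ?thesis
      by (simp add: H_def power_mult_distrib algebra_simps)
  qed
  moreover have "H x y 0 = x ^ d" for x y
  proof -
    \<comment> \<open>Every exponent of z is at least 2, so no \<open>0 ^ 0\<close> occurs.\<close>
    have "(\<Sum>(i, j)\<in>?P. G i j * x ^ i * y ^ j * 0 ^ (d - i - j)) = 0"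
      using d by (intro sum.neutral) auto
    then show ?thesis by (simp add: H_def)
  qed
  moreover have "H x y 1 = x ^ d + y ^ (d - 1) - g x y" for x y
    by (simp add: H_def G sum.Sigma)
  ultimately show ?thesis using plane irr by blast
qed

text \<open>\<open>meets\<close> supplies the curve points on the lines y = ax + b, and
  \<open>vertical\<close> supplies a point off the curve on each affine vertical line. All remaining
  incidences are read off at z = 0, where the form is x^d.\<close>

lemma total_flex_blocking:
  fixes p d :: nat and g :: "int \<Rightarrow> int \<Rightarrow> int"
  assumes p: "Factorial_Ring.prime p" and d: "2 \<le> d" and g: "bipoly (d - 2) g"
    and meets: "\<And>a b. \<exists>x. [x ^ d + (a * x + b) ^ (d - 1) - g x (a * x + b) = 0] (mod int p)"
    and vertical: "\<And>x. \<exists>y. \<not> [x ^ d + y ^ (d - 1) - g x y = 0] (mod int p)"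
  defines "K \<equiv> residue_ring (int p)"
  shows "\<exists>F. plane_curve K d F \<and> geometrically_irreducible K F \<and> nontrivially_blocking K F"
proof -
  interpret residues_prime p K
    using p by unfold_locales (simp_all add: K_def)
  obtain F H where F: "plane_curve K d F" "geometrically_irreducible K F"
    and ev: "\<And>x y z. poly3_eval K F (x mod int p, y mod int p, z mod int p) = H x y z mod int p"
    and hom: "\<And>c x y z. H (c * x) (c * y) (c * z) = c ^ d * H x y z"
    and H0: "\<And>x y. H x y 0 = x ^ d"
    and H1: "\<And>x y. H x y 1 = x ^ d + y ^ (d - 1) - g x y"
    using total_flex_form[OF p d g, folded K_def] by blast
  let ?pt = "\<lambda>x y z. proj_point K (x mod int p, y mod int p, z mod int p)"
  have p1: "1 < int p" using p prime_gt_1_nat by simp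
  have nzt: "(x mod int p, y mod int p, z mod int p) \<in> nonzero_triples K"
    if "\<not> (int p dvd x \<and> int p dvd y \<and> int p dvd z)" for x y z
    using that by (auto simp: nonzero_triples_def mod_carrier res_zero_eq)
  have on_curve: "?pt x y z \<in> curve_points K F"
    if "\<not> (int p dvd x \<and> int p dvd y \<and> int p dvd z)" "[H x y z = 0] (mod int p)" for x y z
    using nzt[OF that(1)] that(2) ev[of x y z]
    unfolding curve_points_def by (auto simp: cong_def res_zero_eq)
  \<comment> \<open>Membership provides a zero at some representative (u,v,w) only; (x,y,z) is
    congruent to a multiple of it, and homogeneity carries the zero over.\<close>
  have off_curve: "?pt x y z \<notin> curve_points K F" if H: "\<not> [H x y z = 0] (mod int p)" for x y z
  proof
    assume "?pt x y z \<in> curve_points K F"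
    then obtain u v w where uvw: "?pt x y z = proj_point K (u, v, w)"
      "(u, v, w) \<in> nonzero_triples K" "poly3_eval K F (u, v, w) = \<zero>\<^bsub>K\<^esub>"
      unfolding curve_points_def by auto
    have "(x mod int p, y mod int p, z mod int p) \<in> ?pt x y z"
      using p1 unfolding proj_point_def
      by (auto simp: res_mult_eq res_zero_eq res_carrier_eq intro!: exI[of _ 1])
    then obtain c where c: "x mod int p = (c * u) mod int p" "y mod int p = (c * v) mod int p"
      "z mod int p = (c * w) mod int p"
      unfolding uvw(1) unfolding proj_point_def by (auto simp: res_mult_eq)
    have "u mod int p = u" "v mod int p = v" "w mod int p = w"
      using uvw(2) by (auto simp: nonzero_triples_def res_carrier_eq)
    then have "[H u v w = 0] (mod int p)"
      using uvw(3) ev[of u v w] by (simp add: cong_def res_zero_eq)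
    then have "[c ^ d * H u v w = c ^ d * 0] (mod int p)" by (intro cong_mult) auto
    moreover have "H x y z mod int p = H (c * u) (c * v) (c * w) mod int p"
      unfolding ev[symmetric] c ..
    ultimately show False using H by (simp add: hom cong_def)
  qed
  have on_line: "?pt x y z \<in> proj_line K (a, b, c)"
    if "\<not> (int p dvd x \<and> int p dvd y \<and> int p dvd z)" "[a * x + b * y + c * z = 0] (mod int p)"
    for a b c x y z
  proof -
    have "a \<otimes>\<^bsub>K\<^esub> (x mod int p) \<oplus>\<^bsub>K\<^esub> b \<otimes>\<^bsub>K\<^esub> (y mod int p) \<oplus>\<^bsub>K\<^esub> c \<otimes>\<^bsub>K\<^esub> (z mod int p) = \<zero>\<^bsub>K\<^esub>"
      using that(2) by (simp add: res_mult_eq res_add_eq res_zero_eq cong_def mod_simps)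
    then show ?thesis using nzt[OF that(1)] unfolding proj_line_def by auto
  qed
  have inverse: "\<exists>b'. [b * b' = 1] (mod int p)" if "b \<in> carrier K" "b \<noteq> 0" for b
  proof -
    have "\<not> int p dvd b" using that by (auto simp: res_carrier_eq dest: zdvd_imp_le)
    then show ?thesis using p_coprime_right_int cong_solve_coprime_int by blast
  qed
  have ndvd1: "\<not> int p dvd 1" using p1 by simp
  have line: "L \<inter> curve_points K F \<noteq> {} \<and> \<not> L \<subseteq> curve_points K F" if Lin: "L \<in> proj_lines K" for L
  proof -
    obtain v where v: "L = proj_line K v" "v \<in> nonzero_triples K"
      using Lin unfolding proj_lines_def by blast
    obtain a b c where "v = (a, b, c)" by (rule prod_cases3)
    with v have L: "L = proj_line K (a, b, c)" and abc: "(a, b, c) \<in> nonzero_triples K" by auto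
    have car: "a \<in> carrier K" "b \<in> carrier K" "c \<in> carrier K" "a \<noteq> 0 \<or> b \<noteq> 0 \<or> c \<noteq> 0"
      using abc by (auto simp: nonzero_triples_def res_zero_eq)
    show ?thesis
    proof (cases "b = 0")
      case False
      then obtain b' where b': "[b * b' = 1] (mod int p)" using inverse car by blast
      have slope: "[b * (b' * t) = t] (mod int p)" for t
        using cong_mult[OF b' cong_refl[of t]] by (simp add: mult.assoc)
      obtain x where x: "[x ^ d + (- (a * b') * x + - (c * b')) ^ (d - 1) -
          g x (- (a * b') * x + - (c * b')) = 0] (mod int p)"
        using meets by blast
      let ?y = "- (a * b') * x + - (c * b')"
      have "a * x + b * ?y + c * 1 = (a * x - b * (b' * (a * x))) + (c - b * (b' * c))"
        by (simp add: algebra_simps)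
      also have "[\<dots> = (a * x - a * x) + (c - c)] (mod int p)"
        by (intro cong_add cong_diff slope cong_refl)
      finally have "?pt x ?y 1 \<in> L" unfolding L using ndvd1 by (intro on_line) auto
      moreover have "?pt x ?y 1 \<in> curve_points K F"
        using x ndvd1 by (intro on_curve) (simp_all add: H1)
      \<comment> \<open>The point at infinity of the line: there the form takes the value 1, so the
        line is not contained in the curve.\<close>
      moreover have "?pt 1 (- (b' * a)) 0 \<in> L"
      proof -
        have "a * 1 + b * (- (b' * a)) + c * 0 = a - b * (b' * a)" by simp
        also have "[\<dots> = a - a] (mod int p)" by (intro cong_diff slope cong_refl)
        finally show ?thesis unfolding L using ndvd1 by (intro on_line) auto
      qed
      moreover have "?pt 1 (- (b' * a)) 0 \<notin> curve_points K F"
        using p1 by (intro off_curve) (simp add: H0 cong_def)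
      ultimately show ?thesis by blast
    next
      case True
      \<comment> \<open>With b = 0 the line passes through [0:1:0], which lies on the curve since
        0^d = 0.\<close>
      have "?pt 0 1 0 \<in> L" unfolding L using ndvd1 True by (intro on_line) auto
      moreover have "?pt 0 1 0 \<in> curve_points K F"
        using ndvd1 d by (intro on_curve) (simp_all add: H0 power_0_left)
      moreover have "\<exists>P\<in>L. P \<notin> curve_points K F"
      proof (cases "a = 0")
        case True
        then have "?pt 1 0 0 \<in> L" unfolding L using ndvd1 \<open>b = 0\<close> by (intro on_line) auto
        moreover have "?pt 1 0 0 \<notin> curve_points K F"
          using p1 by (intro off_curve) (simp add: H0 cong_def)
        ultimately show ?thesis by blast
      next
        case False
        then obtain a' where a': "[a * a' = 1] (mod int p)" using inverse car by blast
        \<comment> \<open>The line is the vertical line x = -c/a, with \<open>a'\<close> the inverse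
          of a modulo p.\<close>
        obtain y where y: "\<not> [(- (a' * c)) ^ d + y ^ (d - 1) - g (- (a' * c)) y = 0] (mod int p)"
          using vertical by blast
        have "a * (- (a' * c)) + b * y + c * 1 = c - (a * a') * c" using True by simp
        also have "[\<dots> = c - 1 * c] (mod int p)"
          using a' by (intro cong_diff cong_mult cong_refl)
        finally have "?pt (- (a' * c)) y 1 \<in> L" unfolding L using ndvd1 by (intro on_line) auto
        moreover have "?pt (- (a' * c)) y 1 \<notin> curve_points K F"
          using y by (intro off_curve) (simp add: H1)
        ultimately show ?thesis by blast
      qed
      ultimately show ?thesis by blast
    qed
  qed
  have "curve_points K F \<subseteq> proj_plane K"
    unfolding curve_points_def proj_plane_def by auto
  then have "nontrivially_blocking K F"
    using line unfolding nontrivially_blocking_def nontrivial_blocking_set_def blocking_set_def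
    by blast
  then show ?thesis using F by blast
qed

section \<open>Choice of the interpolant in every degree\<close>

lemma fermat_cong:
  fixes p :: nat and x :: int
  assumes p: "Factorial_Ring.prime p"
  shows "[x ^ p = x] (mod int p)"
proof (cases "int p dvd x")
  case True
  then have "int p dvd x ^ p" using p by (meson dvd_power dvd_trans prime_gt_0_nat)
  then show ?thesis using True by (simp add: cong_def dvd_eq_mod_eq_0)
next
  case False
  have p0: "0 < int p" using p prime_gt_0_nat by simp
  define a where "a = nat (x mod int p)"
  have a: "int a = x mod int p" using p0 by (simp add: a_def)
  then have ax: "[int a = x] (mod int p)" by simp
  then have "\<not> p dvd a" using False a by (metis dvd_mod_iff dvd_refl int_dvd_int_iff)
  then have "[a ^ (p - 1) = 1] (mod p)" by (rule fermat_theorem[OF p])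
  then have "[int a ^ (p - 1) = 1] (mod int p)" by (metis cong_int_iff of_nat_1 of_nat_power)
  then have "[int a ^ (p - 1) * int a = 1 * int a] (mod int p)" by (intro cong_mult) auto
  moreover have "int a ^ (p - 1) * int a = int a ^ p" using p0 by (metis of_nat_0_less_iff power_minus_mult)
  ultimately have "[int a ^ p = int a] (mod int p)" by simp
  then show ?thesis using ax cong_pow[OF ax, of p] by (metis cong_sym cong_trans)
qed

text \<open>Above degree \<open>p\<close> the interpolant is modified so that \<open>x^d + y^(d-1) - g\<close> and
  \<open>y^(p-1) - h\<close> are the same function on \<open>F_p \<times> F_p\<close>; the latter has degree \<open>p - 1\<close> in \<open>y\<close>.\<close>

lemma blocking_curve_exists:
  fixes p m d :: nat
  assumes p: "Factorial_Ring.prime p" and m: "0 < m" "2 * m + 1 \<le> p" and d: "2 * m \<le> d"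
    and small: "(p - m) ^ m * p ^ 2 < p ^ m"
  defines "K \<equiv> residue_ring (int p)"
  shows "\<exists>F. plane_curve K d F \<and> geometrically_irreducible K F \<and> nontrivially_blocking K F"
proof -
  have p2: "2 \<le> p" using p prime_ge_2_nat by blast
  obtain T where T: "\<And>c. T c \<subseteq> {0..<int p} \<and> card (T c) = m"
    and cover: "\<And>a b. \<exists>c<m. (a * int c + b) mod int p \<in> T c"
    using few_columns_meet_lines[OF _ _ small] m by auto
  \<comment> \<open>For \<open>p \<le> n\<close> the lowered exponent is still at least 1, so the
    congruence also holds when p divides x.\<close>
  have fermat: "[x ^ n = x ^ (n - (p - 1))] (mod int p)" if "p \<le> n" for x :: int and n
  proof -
    have "[x ^ p * x ^ (n - p) = x * x ^ (n - p)] (mod int p)" by (intro cong_mult fermat_cong[OF p]) auto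
    moreover have "x ^ p * x ^ (n - p) = x ^ n" using that by (simp flip: power_add)
    moreover have "x * x ^ (n - p) = x ^ (n - (p - 1))"
    proof -
      have "Suc (n - p) = n - (p - 1)" using that p2 by linarith
      then show ?thesis by (metis power_Suc)
    qed
    ultimately show ?thesis by simp
  qed
  \<comment> \<open>Interpolating \<open>v\<close> at the chosen points makes every line y = ax + b
    contain a solution. The interpolant has degree at most m - 1 in each variable, so total degree
    at most 2m - 2. The assumption on \<open>v\<close> is needed because the sets \<open>T c\<close>
    contain reduced residues only.\<close>
  have interp: "\<exists>A. (\<forall>N\<ge>2 * m - 2. bipoly N (\<lambda>x y. \<Sum>i<m. \<Sum>j<m. A i j * x ^ i * y ^ j)) \<and>
      (\<forall>a b. \<exists>x. [v x (a * x + b) = (\<Sum>i<m. \<Sum>j<m. A i j * x ^ i * (a * x + b) ^ j)] (mod int p))"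
    if v: "\<And>x y. [v x (y mod int p) = v x y] (mod int p)" for v :: "int \<Rightarrow> int \<Rightarrow> int"
  proof -
    obtain A where A: "\<forall>c<m. \<forall>t\<in>T c.
        [(\<Sum>i<m. \<Sum>j<m. A i j * int c ^ i * t ^ j) = v (int c) t] (mod int p)"
      using column_interpolation[OF p, of m T v] T m by auto
    have "bipoly N (\<lambda>x y. \<Sum>i<m. \<Sum>j<m. A i j * x ^ i * y ^ j)" if "2 * m - 2 \<le> N" for N
      using that by (intro bipoly_sum bipoly_monom) auto
    moreover have "\<exists>x. [v x (a * x + b) = (\<Sum>i<m. \<Sum>j<m. A i j * x ^ i * (a * x + b) ^ j)] (mod int p)"
      for a b
    proof -
      obtain c where c: "c < m" "(a * int c + b) mod int p \<in> T c" using cover by blast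
      let ?y = "a * int c + b"
      have "[v (int c) ?y = v (int c) (?y mod int p)] (mod int p)" by (rule cong_sym[OF v])
      also have "[v (int c) (?y mod int p) =
          (\<Sum>i<m. \<Sum>j<m. A i j * int c ^ i * (?y mod int p) ^ j)] (mod int p)"
        using A[rule_format, OF c] by (rule cong_sym)
      also have "[(\<Sum>i<m. \<Sum>j<m. A i j * int c ^ i * (?y mod int p) ^ j) =
          (\<Sum>i<m. \<Sum>j<m. A i j * int c ^ i * ?y ^ j)] (mod int p)"
        by (intro cong_sum cong_mult cong_pow cong_refl) (simp_all only: cong_mod_left cong_refl)
      finally show ?thesis by blast
    qed
    ultimately show ?thesis by blast
  qed
  have fiber: "(\<Sum>i<m. \<Sum>j<m. A i j * x ^ i * y ^ j) = (\<Sum>j<m. (\<Sum>i<m. A i j * x ^ i) * y ^ j)"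
    for A and x y :: int
    by (subst sum.swap) (simp add: sum_distrib_right)
  show ?thesis
  proof (cases "d \<le> p")
    case True
    have "[x ^ d + (y mod int p) ^ (d - 1) = x ^ d + y ^ (d - 1)] (mod int p)" for x y
      by (intro cong_add cong_pow) auto
    from interp[of "\<lambda>x y. x ^ d + y ^ (d - 1)", OF this]
    obtain A where A: "\<And>N. 2 * m - 2 \<le> N \<Longrightarrow> bipoly N (\<lambda>x y. \<Sum>i<m. \<Sum>j<m. A i j * x ^ i * y ^ j)"
      and meets: "\<And>a b. \<exists>x. [x ^ d + (a * x + b) ^ (d - 1) =
        (\<Sum>i<m. \<Sum>j<m. A i j * x ^ i * (a * x + b) ^ j)] (mod int p)"
      by blast
    show ?thesis unfolding K_def
    proof (rule total_flex_blocking[OF p])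
      show "2 \<le> d" using d m by simp
      show "bipoly (d - 2) (\<lambda>x y. \<Sum>i<m. \<Sum>j<m. A i j * x ^ i * y ^ j)" using A d by simp
      show "\<exists>x. [x ^ d + (a * x + b) ^ (d - 1) -
          (\<Sum>i<m. \<Sum>j<m. A i j * x ^ i * (a * x + b) ^ j) = 0] (mod int p)" for a b
        using meets[of a b] by (simp add: cong_diff_iff_cong_0)
      \<comment> \<open>Here d - 1 < p, and \<open>2 * m \<le> d\<close> gives
        \<open>m \<le> d - 1\<close>, so each column carries a monic polynomial in y of degree below
        p.\<close>
      show "\<exists>y. \<not> [x ^ d + y ^ (d - 1) - (\<Sum>i<m. \<Sum>j<m. A i j * x ^ i * y ^ j) = 0] (mod int p)" for x
        unfolding fiber using d m True p2 by (intro monic_not_zero_mod_prime[OF p]) auto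
    qed
  next
    case False
    have "[(y mod int p) ^ (p - 1) = y ^ (p - 1)] (mod int p)" for y
      by (intro cong_pow) auto
    from interp[of "\<lambda>x y. y ^ (p - 1)", OF this]
    obtain A where A: "\<And>N. 2 * m - 2 \<le> N \<Longrightarrow> bipoly N (\<lambda>x y. \<Sum>i<m. \<Sum>j<m. A i j * x ^ i * y ^ j)"
      and meets: "\<And>a b. \<exists>x. [(a * x + b) ^ (p - 1) =
        (\<Sum>i<m. \<Sum>j<m. A i j * x ^ i * (a * x + b) ^ j)] (mod int p)"
      by blast
    let ?h = "\<lambda>x y. \<Sum>i<m. \<Sum>j<m. A i j * x ^ i * y ^ j"
    define g where "g x y = x ^ (d - (p - 1)) + y ^ (d - 1 - (p - 1)) + (- (y ^ (p - 1)) + ?h x y)" for x y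
    have same: "[x ^ d + y ^ (d - 1) - g x y = y ^ (p - 1) - ?h x y] (mod int p)" for x y
    proof -
      have "[x ^ d + y ^ (d - 1) - g x y =
          x ^ (d - (p - 1)) + y ^ (d - 1 - (p - 1)) - g x y] (mod int p)"
        using False by (intro cong_diff cong_add fermat cong_refl) auto
      then show ?thesis by (simp add: g_def)
    qed
    have zero_iff: "[x ^ d + y ^ (d - 1) - g x y = 0] (mod int p) \<longleftrightarrow>
        [y ^ (p - 1) - ?h x y = 0] (mod int p)" for x y
      using same[of x y] by (simp only: unique_euclidean_semiring_class.cong_def)
    show ?thesis unfolding K_def
    proof (rule total_flex_blocking[OF p])
      show "2 \<le> d" using d m by simp
      \<comment> \<open>The degrees fit: \<open>3 \<le> p\<close> makes d - (p - 1) at most d - 2,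
        and d > p makes p - 1 at most d - 2.\<close>
      show "bipoly (d - 2) g" unfolding g_def
        using bipoly_monom[of "d - (p - 1)" 0 "d - 2" 1] bipoly_monom[of 0 "d - 1 - (p - 1)" "d - 2" 1]
          bipoly_monom[of 0 "p - 1" "d - 2" 1] m False d
        by (intro bipoly_add bipoly_uminus A) auto
      show "\<exists>x. [x ^ d + (a * x + b) ^ (d - 1) - g x (a * x + b) = 0] (mod int p)" for a b
        using meets[of a b] unfolding zero_iff by (simp only: cong_diff_iff_cong_0)
      have "\<exists>y. \<not> [0 + y ^ (p - 1) - ?h x y = 0] (mod int p)" for x
        unfolding fiber using m p2 by (intro monic_not_zero_mod_prime[OF p]) auto
      then show "\<exists>y. \<not> [x ^ d + y ^ (d - 1) - g x y = 0] (mod int p)" for x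
        unfolding zero_iff by (simp only: add_0)
    qed
  qed
qed

section \<open>The size estimate and the conclusion\<close>

text \<open>By \<open>1 - t \<le> exp (- t)\<close>, the m-th power of 1 - m/p is at most
  exp(-m^2/p). The exponent 3/4 makes m^2/p at least the square root of p, which exceeds 2 ln
  p.\<close>

lemma small_uncovered:
  fixes p m :: nat
  assumes p: "0 < p" and m: "real p powr (3/4) \<le> real m" "m \<le> p"
    and ln: "2 * ln (real p) < real p powr (1/2)"
  shows "(p - m) ^ m * p ^ 2 < p ^ m"
proof -
  have "real p powr (1/2) * real p = (real p powr (3/4)) ^ 2"
    using p powr_add[of "real p" "1/2" 1] by (simp add: powr_power)
  also have "\<dots> \<le> real m ^ 2" using m by (intro power_mono) auto
  finally have sq: "real p powr (1/2) \<le> real m ^ 2 / real p" using p by (simp add: field_simps)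
  have "(1 - real m / real p) ^ m \<le> exp (- (real m / real p)) ^ m"
    using m p exp_ge_add_one_self[of "- (real m / real p)"] by (intro power_mono) auto
  also have "\<dots> = exp (- (real m ^ 2 / real p))"
    by (simp add: exp_of_nat_mult[symmetric] power2_eq_square)
  also have "\<dots> < exp (- (2 * ln (real p)))" using sq ln by simp
  also have "\<dots> = 1 / real p ^ 2"
    using p by (simp add: exp_minus exp_double field_simps)
  finally have "(1 - real m / real p) ^ m * real p ^ 2 < 1" using p by (simp add: field_simps)
  then have lt: "(1 - real m / real p) ^ m * real p ^ 2 * real p ^ m < 1 * real p ^ m"
    using p by (intro mult_strict_right_mono) auto
  have "real (p - m) = (1 - real m / real p) * real p"
    using p m by (simp add: left_diff_distrib of_nat_diff)
  then have "real (p - m) ^ m * real p ^ 2 = (1 - real m / real p) ^ m * real p ^ 2 * real p ^ m"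
    by (simp add: power_mult_distrib)
  then have "real (p - m) ^ m * real p ^ 2 < real p ^ m" using lt by linarith
  then show ?thesis by (metis of_nat_less_iff of_nat_mult of_nat_power)
qed

theorem theorem1p6:
  shows "infinite {p :: nat. Factorial_Ring.prime p \<and>
           (\<forall>d :: int. real_of_int d \<ge> 4 * real p powr (3/4) + 1 \<longrightarrow>
              (\<exists>F :: int poly3. plane_curve (residue_ring (int p)) (nat d) F \<and>
                   geometrically_irreducible (residue_ring (int p)) F \<and>
                   nontrivially_blocking (residue_ring (int p)) F))}"
    (is "infinite {p. Factorial_Ring.prime p \<and> ?Q p}")
proof -
  \<comment> \<open>Every sufficiently large prime qualifies. The second inequality leaves room for
    rounding p^(3/4) up and still having \<open>2 * m + 1 \<le> p\<close>.\<close>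
  have "eventually (\<lambda>p :: nat. 1 \<le> p \<and> 2 * (real p powr (3/4) + 1) + 1 \<le> real p \<and>
      2 * ln (real p) < real p powr (1/2)) sequentially"
    by (intro eventually_conj eventually_ge_at_top) real_asymp+
  then obtain N :: nat where N: "\<And>p. N \<le> p \<Longrightarrow> 1 \<le> p \<and>
      2 * (real p powr (3/4) + 1) + 1 \<le> real p \<and> 2 * ln (real p) < real p powr (1/2)"
    unfolding eventually_sequentially by blast
  have "?Q p" if p: "Factorial_Ring.prime p" "N \<le> p" for p
  proof (intro allI impI)
    fix d :: int assume d: "real_of_int d \<ge> 4 * real p powr (3/4) + 1"
    define m where "m = nat \<lceil>real p powr (3/4)\<rceil>"
    have p1: "1 \<le> real p" using N[OF p(2)] by simp
    then have m1: "1 \<le> real p powr (3/4)" by (simp add: ge_one_powr_ge_zero)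
    have m: "real p powr (3/4) \<le> real m" "real m < real p powr (3/4) + 1"
      unfolding m_def using m1 by linarith+
    have "real (2 * m + 1) \<le> real p" using N[OF p(2)] m by simp
    then have mp: "2 * m + 1 \<le> p" by (simp only: of_nat_le_iff)
    \<comment> \<open>With P = p^(3/4) at least 1, 2m < 2P + 2 and 2P + 2 is at most 4P + 1.\<close>
    have "real_of_int (int (2 * m)) \<le> real_of_int d" using d m m1 by simp
    then have md: "int (2 * m) \<le> d" by (simp only: of_int_le_iff)
    show "\<exists>F :: int poly3. plane_curve (residue_ring (int p)) (nat d) F \<and>
        geometrically_irreducible (residue_ring (int p)) F \<and>
        nontrivially_blocking (residue_ring (int p)) F"
    proof (rule blocking_curve_exists[OF p(1)])
      show "0 < m" using m m1 by linarith
      show "2 * m + 1 \<le> p" by (rule mp)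
      show "2 * m \<le> nat d" using md by linarith
      show "(p - m) ^ m * p ^ 2 < p ^ m"
        using N[OF p(2)] mp m by (intro small_uncovered) auto
    qed
  qed
  \<comment> \<open>Only primes below N can fail, so finiteness of the qualifying set would make the
    set of all primes finite.\<close>
  then have "{p. Factorial_Ring.prime p} \<subseteq> {p. Factorial_Ring.prime p \<and> ?Q p} \<union> {..<N}"
    using not_le by blast
  moreover have "infinite {p :: nat. Factorial_Ring.prime p}" by (rule primes_infinite)
  ultimately show ?thesis by (meson finite_UnI finite_lessThan finite_subset)
qed

end
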